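(* Let $m,n$ be positive integers and let $\mathcal{A}^I=[\underline{\mathcal{A}},\overline{\mathcal{A}}]$ be an interval double B-tensor in $T_{m,n}$. Then precisely one of the following is satisfied: (a) $\mathcal{A}^I$ is an interval B-tensor; or (b) there is a unique $j_1\in[n]$ such that $$\sum_{j_2,\dots,j_m=1}^n\underline{a}_{j_1j_2\cdots j_m}\le 0,$$ or there is $(l_2,\dots,l_m)\neq(j_1,\dots,j_1)$ such that $$\underline{a}_{j_1j_1\cdots j_1}-\overline{a}_{j_1l_2\cdots l_m}=\sum_{\substack{(j_2,\dots,j_m)\neq(j_1,\dots,j_1)\\(j_2,\dots,j_m)\neq(l_2,\dots,l_m)}}(\overline{a}_{j_1l_2\cdots l_m}-\underline{a}_{j_1j_2\cdots j_m}),$$ and for all $i_1\in[n]\setminus\{j_1\}$, $$\sum_{i_2,\dots,i_m=1}^n\underline{a}_{i_1i_2\cdots i_m}>0,$$ or there is $(l_2,\dots,l_m)\neq(i_1,\dots,i_1)$ such that $$\underline{a}_{i_1i_1\cdots i_1}-\overline{a}_{i_1l_2\cdots l_m}>\sum_{\substack{(j_2,\dots,j_m)\neq(i_1,\dots,i_1)\\(j_2,\dots,j_m)\neq(l_2,\dots,l_m)}}(\overline{a}_{i_1l_2\cdots l_m}-\underline{a}_{i_1j_2\cdots j_m}).$$ (Here (b) has the form: there is a unique $j_1$ with [first condition or second condition] and, for all $i_1\ne j_1$, [third condition or fourth condition].)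
   Context: $[n]=\{1,\dots,n\}$. $T_{m,n}$ is the set of real tensors $\mathcal{A}=(a_{i_1i_2\cdots i_m})$ with all indices in $[n]$. All index tuples $(i_2,\dots,i_m)$, $(j_2,\dots,j_m)$, $(l_2,\dots,l_m)$ range over $[n]^{m-1}$. For $\underline{\mathcal{A}}=(\underline{a}_{i_1\cdots i_m})\le\overline{\mathcal{A}}=(\overline{a}_{i_1\cdots i_m})$ in $T_{m,n}$ (entrywise), the interval tensor is $\mathcal{A}^I=[\underline{\mathcal{A}},\overline{\mathcal{A}}]=\{\mathcal{A}\in T_{m,n}:\underline{\mathcal{A}}\le\mathcal{A}\le\overline{\mathcal{A}}\}$. B-tensor: $\mathcal{A}\in T_{m,n}$ is a B-tensor if for all $i_1\in[n]$: $\sum_{i_2,\dots,i_m=1}^n a_{i_1i_2\cdots i_m}>0$, and $\frac{1}{n^{m-1}}\sum_{i_2,\dots,i_m=1}^n a_{i_1i_2\cdots i_m}>a_{i_1j_2\cdots j_m}$ for all $(j_2,\dots,j_m)\neq(i_1,\dots,i_1)$. For $\mathcal{A}\in T_{m,n}$ and $i_1\in[n]$, $\gamma_{i_1}^+(\mathcal{A}):=\max\{0,a_{i_1i_2\cdots i_m}:(i_2,\dots,i_m)\neq(i_1,\dots,i_1)\}$. Double B-tensor: $\mathcal{A}\in T_{m,n}$ is a double B-tensor if for all $i_1\in[n]$: (i) $a_{i_1i_1\cdots i_1}>\gamma_{i_1}^+(\mathcal{A})$; (ii) $a_{i_1i_1\cdots i_1}-\gamma_{i_1}^+(\mathcal{A})\ge\sum_{(i_2,\dots,i_m)\neq(i_1,\dots,i_1)}(\gamma_{i_1}^+(\mathcal{A})-a_{i_1i_2\cdots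 i_m})$; (iii) for all $j_1\neq i_1$, $$(a_{i_1\cdots i_1}-\gamma_{i_1}^+(\mathcal{A}))(a_{j_1\cdots j_1}-\gamma_{j_1}^+(\mathcal{A}))>\Big(\sum_{(i_2,\dots,i_m)\neq(i_1,\dots,i_1)}(\gamma_{i_1}^+(\mathcal{A})-a_{i_1i_2\cdots i_m})\Big)\Big(\sum_{(j_2,\dots,j_m)\neq(j_1,\dots,j_1)}(\gamma_{j_1}^+(\mathcal{A})-a_{j_1j_2\cdots j_m})\Big).$$ $\mathcal{A}^I$ is an interval B-tensor (resp. interval double B-tensor) if every $\mathcal{A}\in\mathcal{A}^I$ is a B-tensor (resp. double B-tensor). *)

theory Defs
  imports Complex_Main "HOL-Library.FuncSet" "HOL-Library.NList"
begin

text \<open>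
  An order \<open>m\<close>, dimension \<open>n\<close> real tensor is a function on index tuples \<open>(i\<^sub>1, \<dots>, i\<^sub>m)\<close>,
  which are lists of length \<open>m\<close> over \<open>{1..n}\<close>. Tensors are \<open>undefined\<close> on all other lists,
  so that equality of tensors is entrywise equality.
\<close>

type_synonym tensor = "nat list \<Rightarrow> real"

definition tensors :: "nat \<Rightarrow> nat \<Rightarrow> tensor set" where
  "tensors m n = nlists m {1..n} \<rightarrow>\<^sub>E UNIV"

text \<open>
  For a row index \<open>i\<close>, the remaining indices \<open>(i\<^sub>2, \<dots>, i\<^sub>m)\<close> form a list \<open>js\<close> of length
  \<open>m - 1\<close>, and the entry is \<open>A (i # js)\<close>. For \<open>m = 1\<close> the only such list is empty and it
  is the diagonal one.
\<close>

definition row_tuples :: "nat \<Rightarrow> nat \<Rightarrow> nat list set" where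
  "row_tuples m n = nlists (m - 1) {1..n}"

definition diag_tuple :: "nat \<Rightarrow> nat \<Rightarrow> nat list" where
  "diag_tuple m i = replicate (m - 1) i"

definition off_diag :: "nat \<Rightarrow> nat \<Rightarrow> nat \<Rightarrow> nat list set" where
  "off_diag m n i = row_tuples m n - {diag_tuple m i}"

definition interval_tensor :: "nat \<Rightarrow> nat \<Rightarrow> tensor \<Rightarrow> tensor \<Rightarrow> tensor set" where
  "interval_tensor m n L U =
     {A \<in> tensors m n. \<forall>is \<in> nlists m {1..n}. L is \<le> A is \<and> A is \<le> U is}"

definition B_tensor :: "nat \<Rightarrow> nat \<Rightarrow> tensor \<Rightarrow> bool" where
  "B_tensor m n A \<longleftrightarrow> A \<in> tensors m n \<and>
     (\<forall>i \<in> {1..n}.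
        (\<Sum>is \<in> row_tuples m n. A (i # is)) > 0 \<and>
        (\<forall>js \<in> off_diag m n i.
           1 / real n ^ (m - 1) * (\<Sum>is \<in> row_tuples m n. A (i # is)) > A (i # js)))"

definition gamma_plus :: "nat \<Rightarrow> nat \<Rightarrow> tensor \<Rightarrow> nat \<Rightarrow> real" where
  "gamma_plus m n A i = Max (insert 0 ((\<lambda>is. A (i # is)) ` off_diag m n i))"

definition double_B_tensor :: "nat \<Rightarrow> nat \<Rightarrow> tensor \<Rightarrow> bool" where
  "double_B_tensor m n A \<longleftrightarrow> A \<in> tensors m n \<and>
     (\<forall>i \<in> {1..n}.
        A (i # diag_tuple m i) > gamma_plus m n A i \<and>
        A (i # diag_tuple m i) - gamma_plus m n A i
          \<ge> (\<Sum>is \<in> off_diag m n i. gamma_plus m n A i - A (i # is)) \<and>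
        (\<forall>j \<in> {1..n}. j \<noteq> i \<longrightarrow>
           (A (i # diag_tuple m i) - gamma_plus m n A i) *
           (A (j # diag_tuple m j) - gamma_plus m n A j)
             > (\<Sum>is \<in> off_diag m n i. gamma_plus m n A i - A (i # is)) *
               (\<Sum>js \<in> off_diag m n j. gamma_plus m n A j - A (j # js))))"

definition interval_B_tensor :: "nat \<Rightarrow> nat \<Rightarrow> tensor \<Rightarrow> tensor \<Rightarrow> bool" where
  "interval_B_tensor m n L U \<longleftrightarrow> (\<forall>A \<in> interval_tensor m n L U. B_tensor m n A)"

definition interval_double_B_tensor :: "nat \<Rightarrow> nat \<Rightarrow> tensor \<Rightarrow> tensor \<Rightarrow> bool" where
  "interval_double_B_tensor m n L U \<longleftrightarrow>
     (\<forall>A \<in> interval_tensor m n L U. double_B_tensor m n A)"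

end

theory Submission
  imports Defs
begin

text \<open>
  Write \<open>N\<close> for the number \<open>n ^ (m - 1)\<close> of entries in a row. The second and third condition
  on a double B-tensor compare \<open>a - \<gamma>\<close>, where \<open>a\<close> is the diagonal entry of a row, with the sum of
  \<open>\<gamma> - x\<close> over the off-diagonal entries \<open>x\<close>. The difference of these two quantities is the
  row sum minus \<open>N * \<gamma>\<close> (\<open>row_sum_minus_multiple\<close>). Hence the second condition says that every row sum is at
  least \<open>N * \<gamma>\<close>, while the row condition of a B-tensor amounts to a strict form of this
  inequality. Call a row tight if the row sum equals \<open>N * \<gamma>\<close>. For two tight rows the two
  products in the third condition are equal, so a double B-tensor has at most one tight row
  (\<open>double_B_tensor_unique_tight\<close>).

  The B-tensor inequalities for a row are affine in its entries, so over an interval tensor they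
  need to be tested only at the extremal rows: all entries minimal, or one off-diagonal entry
  maximal and all others minimal. In an interval double B-tensor these inequalities hold weakly
  at the extremal rows, so the interval is an interval B-tensor exactly if none of them becomes
  an equality, that is, if no row is degenerate in the sense of the first two alternatives in
  the statement (\<open>interval_B_tensor_iff_no_degenerate_row\<close>). A degenerate row is tight for some choice of
  its entries. Entries of different rows can be chosen independently, so two degenerate rows
  would give a member of the interval with two tight rows (\<open>degenerate_row_unique\<close>). Therefore
  either no row is degenerate or exactly one is, and in the latter case the remaining rows have
  positive minimal row sums.
\<close>

section \<open>Rows of a tensor\<close>

definition row_sum :: "nat \<Rightarrow> nat \<Rightarrow> tensor \<Rightarrow> nat \<Rightarrow> real" where
  "row_sum m n A i = (\<Sum>js \<in> row_tuples m n. A (i # js))"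

lemma finite_row_tuples [simp]: "finite (row_tuples m n)"
  and card_row_tuples: "card (row_tuples m n) = n ^ (m - 1)"
proof -
  have eq: "row_tuples m n = {xs. set xs \<subseteq> {1..n} \<and> length xs = m - 1}"
    unfolding row_tuples_def nlists_def by blast
  show "finite (row_tuples m n)"
    unfolding eq by (rule finite_lists_length_eq) simp
  show "card (row_tuples m n) = n ^ (m - 1)"
    unfolding eq by (subst card_lists_length_eq) simp_all
qed

lemma finite_off_diag [simp]: "finite (off_diag m n i)"
  by (simp add: off_diag_def)

lemma off_diag_subset: "js \<in> off_diag m n i \<Longrightarrow> js \<in> row_tuples m n"
  by (simp add: off_diag_def)

lemma diag_tuple_in_row_tuples: "i \<in> {1..n} \<Longrightarrow> diag_tuple m i \<in> row_tuples m n"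
  unfolding diag_tuple_def row_tuples_def by (rule nlists_replicateI)

lemma Cons_row_tuple_in_nlists:
  "m > 0 \<Longrightarrow> i \<in> {1..n} \<Longrightarrow> js \<in> row_tuples m n \<Longrightarrow> i # js \<in> nlists m {1..n}"
  using Cons_in_nlists_Suc[of i js "m - 1"] by (simp add: row_tuples_def)

text \<open>
  This identity links the two notions: with \<open>c = gamma_plus m n A i\<close> it turns the double
  B-tensor conditions into statements on row sums, and with \<open>c\<close> an off-diagonal entry it
  turns the B-tensor condition into the form used in the theorem.
\<close>

lemma row_sum_minus_multiple:
  assumes "i \<in> {1..n}"
  shows "row_sum m n A i - real n ^ (m - 1) * c
    = (A (i # diag_tuple m i) - c) - (\<Sum>js \<in> off_diag m n i. c - A (i # js))"
proof -
  have "row_sum m n A i - real n ^ (m - 1) * c = (\<Sum>js \<in> row_tuples m n. A (i # js) - c)"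
    by (simp add: row_sum_def sum_subtractf card_row_tuples)
  also have "\<dots> = (A (i # diag_tuple m i) - c) + (\<Sum>js \<in> off_diag m n i. A (i # js) - c)"
    unfolding off_diag_def
    by (rule sum.remove) (use assms diag_tuple_in_row_tuples in auto)
  also have "\<dots> = (A (i # diag_tuple m i) - c) - (\<Sum>js \<in> off_diag m n i. c - A (i # js))"
    by (simp add: sum_subtractf)
  finally show ?thesis .
qed

lemma row_sum_minus_entry:
  assumes "i \<in> {1..n}" and "ls \<in> off_diag m n i"
  shows "row_sum m n A i - real n ^ (m - 1) * A (i # ls)
    = (A (i # diag_tuple m i) - A (i # ls))
      - (\<Sum>js \<in> off_diag m n i - {ls}. A (i # ls) - A (i # js))"
  using row_sum_minus_multiple[OF assms(1), of m A "A (i # ls)"]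
  by (simp add: sum.remove[OF finite_off_diag assms(2)])

lemma gamma_plus_nonneg: "gamma_plus m n A i \<ge> 0"
  by (simp add: gamma_plus_def)

lemma gamma_plus_ge_entry: "js \<in> off_diag m n i \<Longrightarrow> A (i # js) \<le> gamma_plus m n A i"
  by (simp add: gamma_plus_def)

lemma B_tensor_iff_row_sum:
  "B_tensor m n A \<longleftrightarrow> A \<in> tensors m n \<and>
     (\<forall>i \<in> {1..n}. row_sum m n A i > 0 \<and>
       (\<forall>js \<in> off_diag m n i. row_sum m n A i > real n ^ (m - 1) * A (i # js)))"
  by (auto simp: B_tensor_def row_sum_def field_simps)


section \<open>Tight rows\<close>

definition tight :: "nat \<Rightarrow> nat \<Rightarrow> tensor \<Rightarrow> nat \<Rightarrow> bool" where
  "tight m n A i \<longleftrightarrow> row_sum m n A i = real n ^ (m - 1) * gamma_plus m n A i"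

lemma double_B_tensor_row_sum_ge:
  assumes "double_B_tensor m n A" and "i \<in> {1..n}"
  shows "row_sum m n A i \<ge> real n ^ (m - 1) * gamma_plus m n A i"
proof -
  have "A (i # diag_tuple m i) - gamma_plus m n A i
      \<ge> (\<Sum>js \<in> off_diag m n i. gamma_plus m n A i - A (i # js))"
    using assms unfolding double_B_tensor_def by blast
  then show ?thesis
    using row_sum_minus_multiple[OF assms(2), of m A "gamma_plus m n A i"] by linarith
qed

lemma double_B_tensor_unique_tight:
  assumes A: "double_B_tensor m n A" and i: "i \<in> {1..n}" and j: "j \<in> {1..n}"
    and "tight m n A i" and "tight m n A j"
  shows "i = j"
proof (rule ccontr)
  assume "i \<noteq> j"
  let ?\<gamma> = "gamma_plus m n A"
  let ?d = "\<lambda>k. A (k # diag_tuple m k) - ?\<gamma> k"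
  let ?s = "\<lambda>k. \<Sum>js \<in> off_diag m n k. ?\<gamma> k - A (k # js)"
  have "?d i * ?d j > ?s i * ?s j"
    using A i j \<open>i \<noteq> j\<close> unfolding double_B_tensor_def by metis
  moreover have "?d i = ?s i" "?d j = ?s j"
    using assms row_sum_minus_multiple[OF i, of m A "?\<gamma> i"]
      row_sum_minus_multiple[OF j, of m A "?\<gamma> j"]
    by (auto simp: tight_def)
  ultimately show False
    by simp
qed

text \<open>
  For a double B-tensor the row sum is at least \<open>N * \<gamma>\<close>, so an upper bound of \<open>N * c\<close>, where
  \<open>c\<close> is 0 or an off-diagonal entry and hence at most \<open>\<gamma>\<close>, forces equality throughout.
\<close>

lemma tight_if_row_sum_le:
  assumes A: "double_B_tensor m n A" and i: "i \<in> {1..n}"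
    and le: "row_sum m n A i \<le> real n ^ (m - 1) * c" and "c \<le> gamma_plus m n A i"
  shows "tight m n A i"
proof -
  have "real n ^ (m - 1) * c \<le> real n ^ (m - 1) * gamma_plus m n A i"
    using assms(4) by (intro mult_left_mono) auto
  then show ?thesis
    using le double_B_tensor_row_sum_ge[OF A i] by (simp add: tight_def)
qed


section \<open>Extremal members of an interval tensor\<close>

definition vertex :: "tensor \<Rightarrow> tensor \<Rightarrow> nat list set \<Rightarrow> tensor" where
  "vertex L U X = (\<lambda>is. if is \<in> X then U is else L is)"

lemma vertex_in_interval_tensor:
  assumes "L \<in> tensors m n" and "U \<in> tensors m n"
    and "\<forall>is \<in> nlists m {1..n}. L is \<le> U is"
  shows "vertex L U X \<in> interval_tensor m n L U"
  using assms by (auto simp: vertex_def interval_tensor_def tensors_def PiE_iff extensional_def)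

lemma tight_cong:
  assumes "\<And>js. A (i # js) = B (i # js)"
  shows "tight m n A i \<longleftrightarrow> tight m n B i"
  using assms by (simp add: tight_def row_sum_def gamma_plus_def)

lemma vertex_singleton_row:
  assumes "i \<in> {1..n}" and "ls \<in> off_diag m n i"
  shows "row_sum m n (vertex L U {i # ls}) i - real n ^ (m - 1) * U (i # ls)
    = (L (i # diag_tuple m i) - U (i # ls))
      - (\<Sum>js \<in> off_diag m n i - {ls}. U (i # ls) - L (i # js))"
  (is "_ = _ - ?s L")
proof -
  let ?V = "vertex L U {i # ls}"
  have "diag_tuple m i \<noteq> ls"
    using assms(2) by (auto simp: off_diag_def)
  moreover have "?s ?V = ?s L"
    by (rule sum.cong) (auto simp: vertex_def)
  ultimately show ?thesis
    using row_sum_minus_entry[OF assms, of ?V] by (simp add: vertex_def)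
qed


section \<open>Degenerate rows\<close>

definition degenerate_row :: "nat \<Rightarrow> nat \<Rightarrow> tensor \<Rightarrow> tensor \<Rightarrow> nat \<Rightarrow> bool" where
  "degenerate_row m n L U j \<longleftrightarrow>
     (\<Sum>js \<in> row_tuples m n. L (j # js)) \<le> 0 \<or>
     (\<exists>ls \<in> off_diag m n j.
        L (j # diag_tuple m j) - U (j # ls)
          = (\<Sum>js \<in> off_diag m n j - {ls}. U (j # ls) - L (j # js)))"

text \<open>
  The set \<open>X\<close> is empty or a singleton. That it stays inside row \<open>i\<close> is what allows the choices
  made for two rows to be combined into one tensor.
\<close>

lemma degenerate_row_tight_vertex:
  assumes LU: "L \<in> tensors m n" "U \<in> tensors m n"
      "\<forall>is \<in> nlists m {1..n}. L is \<le> U is"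
    and dbl: "interval_double_B_tensor m n L U"
    and i: "i \<in> {1..n}" and deg: "degenerate_row m n L U i"
  shows "\<exists>X \<subseteq> range ((#) i). tight m n (vertex L U X) i"
proof -
  have V: "double_B_tensor m n (vertex L U X)" for X
    using dbl vertex_in_interval_tensor[OF LU] by (auto simp: interval_double_B_tensor_def)
  from deg consider (sum) "row_sum m n L i \<le> 0"
    | (entry) ls where "ls \<in> off_diag m n i"
        "L (i # diag_tuple m i) - U (i # ls)
          = (\<Sum>js \<in> off_diag m n i - {ls}. U (i # ls) - L (i # js))"
    by (auto simp: degenerate_row_def row_sum_def)
  then show ?thesis
  proof cases
    case sum
    then have "row_sum m n (vertex L U {}) i \<le> real n ^ (m - 1) * 0"
      by (simp add: vertex_def)
    from tight_if_row_sum_le[OF V i this gamma_plus_nonneg] show ?thesis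
      by blast
  next
    case entry
    let ?V = "vertex L U {i # ls}"
    have "row_sum m n ?V i \<le> real n ^ (m - 1) * U (i # ls)"
      using vertex_singleton_row[OF i entry(1), of L U] entry(2) by simp
    moreover have "U (i # ls) \<le> gamma_plus m n ?V i"
      using gamma_plus_ge_entry[OF entry(1), of ?V] by (simp add: vertex_def)
    ultimately have "tight m n ?V i"
      by (rule tight_if_row_sum_le[OF V i])
    then show ?thesis
      by (intro exI[of _ "{i # ls}"]) simp
  qed
qed

lemma degenerate_row_unique:
  assumes LU: "L \<in> tensors m n" "U \<in> tensors m n"
      "\<forall>is \<in> nlists m {1..n}. L is \<le> U is"
    and dbl: "interval_double_B_tensor m n L U"
    and i: "i \<in> {1..n}" and j: "j \<in> {1..n}"
    and deg: "degenerate_row m n L U i" "degenerate_row m n L U j"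
  shows "i = j"
proof (rule ccontr)
  assume "i \<noteq> j"
  obtain X where X: "X \<subseteq> range ((#) i)" "tight m n (vertex L U X) i"
    using degenerate_row_tight_vertex[OF LU dbl i deg(1)] by blast
  obtain Y where Y: "Y \<subseteq> range ((#) j)" "tight m n (vertex L U Y) j"
    using degenerate_row_tight_vertex[OF LU dbl j deg(2)] by blast
  let ?A = "vertex L U (X \<union> Y)"
  have "tight m n ?A i \<longleftrightarrow> tight m n (vertex L U X) i"
    by (rule tight_cong) (use Y(1) \<open>i \<noteq> j\<close> in \<open>auto simp: vertex_def\<close>)
  moreover have "tight m n ?A j \<longleftrightarrow> tight m n (vertex L U Y) j"
    by (rule tight_cong) (use X(1) \<open>i \<noteq> j\<close> in \<open>auto simp: vertex_def\<close>)
  moreover have "double_B_tensor m n ?A"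
    using dbl vertex_in_interval_tensor[OF LU] by (auto simp: interval_double_B_tensor_def)
  ultimately show False
    using double_B_tensor_unique_tight[of m n ?A i j] i j X(2) Y(2) \<open>i \<noteq> j\<close> by simp
qed

text \<open>
  The slack of each B-tensor inequality is smallest at an extremal row. There the double B-tensor
  property makes it nonnegative, so it is positive unless the row is degenerate.
\<close>

lemma interval_B_tensor_iff_no_degenerate_row:
  assumes "m > 0"
    and LU: "L \<in> tensors m n" "U \<in> tensors m n"
      "\<forall>is \<in> nlists m {1..n}. L is \<le> U is"
    and dbl: "interval_double_B_tensor m n L U"
  shows "interval_B_tensor m n L U \<longleftrightarrow> (\<forall>i \<in> {1..n}. \<not> degenerate_row m n L U i)"
proof (intro iffI ballI)
  fix i assume B: "interval_B_tensor m n L U" and i: "i \<in> {1..n}"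
  have V: "B_tensor m n (vertex L U X)" for X
    using B vertex_in_interval_tensor[OF LU] by (auto simp: interval_B_tensor_def)
  have "row_sum m n L i > 0"
    using V[of "{}"] i by (auto simp: B_tensor_iff_row_sum vertex_def)
  moreover have "L (i # diag_tuple m i) - U (i # ls)
      \<noteq> (\<Sum>js \<in> off_diag m n i - {ls}. U (i # ls) - L (i # js))"
    if ls: "ls \<in> off_diag m n i" for ls
  proof -
    have "row_sum m n (vertex L U {i # ls}) i
        > real n ^ (m - 1) * vertex L U {i # ls} (i # ls)"
      using V[of "{i # ls}"] i ls unfolding B_tensor_iff_row_sum by blast
    then show ?thesis
      using vertex_singleton_row[OF i ls, of L U] by (simp add: vertex_def)
  qed
  ultimately show "\<not> degenerate_row m n L U i"
    by (auto simp: degenerate_row_def row_sum_def)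
next
  assume nondeg: "\<forall>i \<in> {1..n}. \<not> degenerate_row m n L U i"
  have V: "double_B_tensor m n (vertex L U X)" for X
    using dbl vertex_in_interval_tensor[OF LU] by (auto simp: interval_double_B_tensor_def)
  show "interval_B_tensor m n L U"
    unfolding interval_B_tensor_def B_tensor_iff_row_sum
  proof (intro ballI conjI)
    fix A assume A: "A \<in> interval_tensor m n L U"
    then show "A \<in> tensors m n"
      by (simp add: interval_tensor_def)
    fix i assume i: "i \<in> {1..n}"
    have bounds: "L (i # js) \<le> A (i # js)" "A (i # js) \<le> U (i # js)"
      if "js \<in> row_tuples m n" for js
      using A Cons_row_tuple_in_nlists[OF \<open>m > 0\<close> i that] by (auto simp: interval_tensor_def)
    have "0 < row_sum m n L i"
      using nondeg i unfolding degenerate_row_def row_sum_def by (meson not_le)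
    also have "\<dots> \<le> row_sum m n A i"
      unfolding row_sum_def by (intro sum_mono bounds)
    finally show "row_sum m n A i > 0" .
    fix ls assume ls: "ls \<in> off_diag m n i"
    let ?V = "vertex L U {i # ls}"
    let ?sL = "\<Sum>js \<in> off_diag m n i - {ls}. U (i # ls) - L (i # js)"
    let ?sA = "\<Sum>js \<in> off_diag m n i - {ls}. A (i # ls) - A (i # js)"
    have "real n ^ (m - 1) * U (i # ls) \<le> real n ^ (m - 1) * gamma_plus m n ?V i"
      using gamma_plus_ge_entry[OF ls, of ?V] by (intro mult_left_mono) (auto simp: vertex_def)
    then have "real n ^ (m - 1) * U (i # ls) \<le> row_sum m n ?V i"
      using double_B_tensor_row_sum_ge[OF V i, of "{i # ls}"] by linarith
    then have "L (i # diag_tuple m i) - U (i # ls) \<ge> ?sL"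
      using vertex_singleton_row[OF i ls, of L U] by linarith
    moreover have "L (i # diag_tuple m i) - U (i # ls) \<noteq> ?sL"
      using nondeg i ls unfolding degenerate_row_def by blast
    moreover have "?sA \<le> ?sL"
      by (intro sum_mono diff_mono bounds) (use ls off_diag_subset in auto)
    moreover have "L (i # diag_tuple m i) \<le> A (i # diag_tuple m i)" "A (i # ls) \<le> U (i # ls)"
      using bounds diag_tuple_in_row_tuples[OF i] off_diag_subset[OF ls] by auto
    ultimately show "row_sum m n A i > real n ^ (m - 1) * A (i # ls)"
      using row_sum_minus_entry[OF i ls, of A] by linarith
  qed
qed


section \<open>The dichotomy\<close>

theorem proposition4p2:
  fixes m n :: nat and L U :: tensor
  assumes "m > 0" and "n > 0"
    and "L \<in> tensors m n" and "U \<in> tensors m n"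
    and "\<forall>is \<in> nlists m {1..n}. L is \<le> U is"
    and "interval_double_B_tensor m n L U"
  shows "interval_B_tensor m n L U \<longleftrightarrow> \<not>
    (\<exists>!j. j \<in> {1..n} \<and>
      ((\<Sum>js \<in> row_tuples m n. L (j # js)) \<le> 0 \<or>
       (\<exists>ls \<in> off_diag m n j.
          L (j # diag_tuple m j) - U (j # ls)
            = (\<Sum>js \<in> off_diag m n j - {ls}. U (j # ls) - L (j # js)))) \<and>
      (\<forall>i \<in> {1..n} - {j}.
         (\<Sum>is \<in> row_tuples m n. L (i # is)) > 0 \<or>
         (\<exists>ls \<in> off_diag m n i.
            L (i # diag_tuple m i) - U (i # ls)
              > (\<Sum>js \<in> off_diag m n i - {ls}. U (i # ls) - L (i # js)))))"
proof -
  let ?third = "\<lambda>i. (\<Sum>is \<in> row_tuples m n. L (i # is)) > 0"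
  let ?fourth = "\<lambda>i. \<exists>ls \<in> off_diag m n i.
    L (i # diag_tuple m i) - U (i # ls)
      > (\<Sum>js \<in> off_diag m n i - {ls}. U (i # ls) - L (i # js))"
  have unique: "i = j" if "i \<in> {1..n}" "j \<in> {1..n}"
    "degenerate_row m n L U i" "degenerate_row m n L U j" for i j
    using degenerate_row_unique[OF assms(3-6)] that by blast
  have third: "?third i" if "\<not> degenerate_row m n L U i" for i
    using that by (auto simp: degenerate_row_def)
  have "(\<exists>i \<in> {1..n}. degenerate_row m n L U i) \<longleftrightarrow>
    (\<exists>!j. j \<in> {1..n} \<and> degenerate_row m n L U j \<and>
       (\<forall>i \<in> {1..n} - {j}. ?third i \<or> ?fourth i))"
  proof
    assume "\<exists>i \<in> {1..n}. degenerate_row m n L U i"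
    then obtain j where j: "j \<in> {1..n}" "degenerate_row m n L U j"
      by blast
    have "?third i" if "i \<in> {1..n} - {j}" for i
      using that j unique third by blast
    then show "\<exists>!j. j \<in> {1..n} \<and> degenerate_row m n L U j \<and>
       (\<forall>i \<in> {1..n} - {j}. ?third i \<or> ?fourth i)"
      using j unique by (intro ex1I[of _ j]) auto
  qed blast
  then show ?thesis
    unfolding interval_B_tensor_iff_no_degenerate_row[OF assms(1,3-6)]
    unfolding degenerate_row_def by blast
qed

end
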